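(* (1) For any graph $G$ with $\chi(G)\geq 4$, one has $\chi_2(G)\leq \chi(G)+\alpha(G)$. (2) If $G$ is a $k$-regular graph with $\chi(G)\geq 4$, then $\chi_2(G)\leq \chi(G)+\alpha(G^2)$.
   Context: Graphs are finite and simple. $\chi(G)$ denotes the chromatic number of $G$ and $\alpha(G)$ its independence number (maximum size of an independent set). A dynamic $l$-coloring of $G$ is a proper vertex coloring of $G$ with colors in $\{1,\ldots,l\}$ such that for every vertex $v$ of degree at least $2$, at least two different colors appear on the neighbors of $v$. The dynamic chromatic number $\chi_2(G)$ is the smallest integer $l$ such that $G$ has a dynamic $l$-coloring. The graph $G^2$ has vertex set $V(G)$, and two different vertices $u,v$ are adjacent in $G^2$ if and only if $d_G(u,v)\leq 2$, where $d_G$ is the distance in $G$. *)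

theory Defs
  imports "Graph_Theory.Graph_Theory"
begin

text \<open>
  Finite simple graphs are the \<^locale>\<open>pair_graph\<close>s: finite, loop-free digraphs
  with a symmetric arc relation, so an edge \<open>uv\<close> is represented by the two arcs \<open>(u, v)\<close> and
  \<open>(v, u)\<close>.  Hence the degree of a vertex is its out-degree, and its neighbours are its
  out-neighbours.
\<close>

definition neighbors :: "'a pair_pre_digraph \<Rightarrow> 'a \<Rightarrow> 'a set" where
  "neighbors G v = {u. (v, u) \<in> parcs G}"

definition regular_graph :: "nat \<Rightarrow> 'a pair_pre_digraph \<Rightarrow> bool" where
  "regular_graph k G \<longleftrightarrow> (\<forall>v\<in>pverts G. out_degree (with_proj G) v = k)"

definition proper_coloring :: "'a pair_pre_digraph \<Rightarrow> nat \<Rightarrow> ('a \<Rightarrow> nat) \<Rightarrow> bool" where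
  "proper_coloring G l c \<longleftrightarrow>
     (\<forall>v\<in>pverts G. c v \<in> {1..l}) \<and> (\<forall>(u, v)\<in>parcs G. c u \<noteq> c v)"

definition dynamic_coloring :: "'a pair_pre_digraph \<Rightarrow> nat \<Rightarrow> ('a \<Rightarrow> nat) \<Rightarrow> bool" where
  "dynamic_coloring G l c \<longleftrightarrow>
     proper_coloring G l c \<and>
     (\<forall>v\<in>pverts G. out_degree (with_proj G) v \<ge> 2 \<longrightarrow> card (c ` neighbors G v) \<ge> 2)"

definition chromatic_number :: "'a pair_pre_digraph \<Rightarrow> nat" where
  "chromatic_number G = (LEAST l. \<exists>c. proper_coloring G l c)"

definition dynamic_chromatic_number :: "'a pair_pre_digraph \<Rightarrow> nat" where
  "dynamic_chromatic_number G = (LEAST l. \<exists>c. dynamic_coloring G l c)"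

definition independent_set :: "'a pair_pre_digraph \<Rightarrow> 'a set \<Rightarrow> bool" where
  "independent_set G S \<longleftrightarrow> S \<subseteq> pverts G \<and> (\<forall>u\<in>S. \<forall>v\<in>S. (u, v) \<notin> parcs G)"

definition independence_number :: "'a pair_pre_digraph \<Rightarrow> nat" where
  "independence_number G = Max {card S | S. independent_set G S}"

text \<open>
  The shortest-path cost for unit arc weights is the usual graph distance; it is \<open>\<infinity>\<close> between
  different components.
\<close>
definition graph_dist :: "'a pair_pre_digraph \<Rightarrow> 'a \<Rightarrow> 'a \<Rightarrow> ereal" where
  "graph_dist G u v = wf_digraph.\<mu> (with_proj G) (\<lambda>_. 1) u v"

definition graph_square :: "'a pair_pre_digraph \<Rightarrow> 'a pair_pre_digraph" where
  "graph_square G =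
     \<lparr> pverts = pverts G,
       parcs = {(u, v). u \<in> pverts G \<and> v \<in> pverts G \<and> u \<noteq> v \<and> graph_dist G u v \<le> 2} \<rparr>"

text \<open>The \<open>LEAST\<close> and \<open>Max\<close> above range over nonempty, respectively finite nonempty, sets.\<close>

lemma ex_dynamic_coloring:
  assumes "pair_graph G"
  shows "\<exists>l c. dynamic_coloring G l c"
proof -
  interpret pair_graph G by fact
  obtain f where f: "bij_betw f {1..card (pverts G)} (pverts G)"
    using ex_bij_betw_nat_finite_1[OF pair_finite_verts] by blast
  define c where "c = inv_into {1..card (pverts G)} f"
  have c: "bij_betw c (pverts G) {1..card (pverts G)}"
    unfolding c_def by (rule bij_betw_inv_into[OF f])
  have inj: "inj_on c (pverts G)" using c by (simp add: bij_betw_def)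
  have nb: "neighbors G v \<subseteq> pverts G" for v
    by (auto simp: neighbors_def dest: in_arcsD2)
  have deg: "out_degree (with_proj G) v = card (neighbors G v)" for v
  proof -
    have "out_arcs (with_proj G) v = Pair v ` neighbors G v"
      by (auto simp: out_arcs_def neighbors_def)
    then show ?thesis
      by (simp add: out_degree_def card_image inj_on_def)
  qed
  have "c u \<noteq> c v" if "(u, v) \<in> parcs G" for u v
    using inj that in_arcsD1[OF that] in_arcsD2[OF that] pair_no_loops[OF that]
    by (auto dest: inj_onD)
  moreover have "card (c ` neighbors G v) = card (neighbors G v)" for v
    using inj nb by (meson card_image inj_on_subset)
  ultimately have "dynamic_coloring G (card (pverts G)) c"
    using bij_betwE[OF c] unfolding dynamic_coloring_def proper_coloring_def
    by (auto simp: deg)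
  then show ?thesis by blast
qed

lemma finite_independent_set_cards:
  assumes "finite (pverts G)"
  shows "finite {card S | S. independent_set G S}" "{card S | S. independent_set G S} \<noteq> {}"
proof -
  have "{card S | S. independent_set G S} \<subseteq> card ` Pow (pverts G)"
    by (auto simp: independent_set_def)
  then show "finite {card S | S. independent_set G S}"
    using assms by (meson finite_Pow_iff finite_imageI finite_subset)
  have "independent_set G {}" by (simp add: independent_set_def)
  then show "{card S | S. independent_set G S} \<noteq> {}" by blast
qed

end

theory Submission
  imports Defs
begin

text \<open>
  A proper coloring fails to be dynamic exactly at its bad vertices, the vertices of degree at least
  two with a monochromatic neighbourhood.  With at least four colors one can recolor so that the bad
  vertices form an independent set (\<open>ex_coloring_independent_bad\<close>).  Then there are at most
  \<open>\<alpha>(G)\<close> of them, and distinct new colors for one neighbour of each give the first bound.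

  For a regular graph, take such a coloring with the fewest bad vertices.  It is enough to find a
  set \<open>F\<close> of vertices such that every neighbourhood of a bad vertex meets both \<open>F\<close> and its
  complement: for each color \<open>i\<close> occurring on the neighbourhood of a bad vertex, the vertices of
  color \<open>i\<close> in \<open>F\<close> receive a common new color.  Bad vertices representing distinct such colors \<open>i\<close>
  have no common neighbour and are not adjacent, so at most \<open>\<alpha>(G\<^sup>2)\<close> new colors are used
  (\<open>dynamic_chromatic_number_le_square\<close>).

  The set \<open>F\<close> exists by a linear algebra criterion of Seymour (\<open>ex_two_coloring\<close>) as soon as every
  nonempty set of bad vertices has more neighbours than members.  By regularity a set of bad
  vertices has at least as many neighbours as members, and equality is possible only if the two
  sets span a union of bipartite components.  Such components can be recolored so that the number of
  bad vertices drops, which contradicts the choice of the coloring (\<open>minimal_bad_expansion\<close>).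
\<close>

section \<open>Bad vertices of a coloring\<close>

text \<open>
  The vertices at which a coloring fails to be dynamic: those of degree at least two whose
  neighbourhood is monochromatic.
\<close>
definition bad_vertices :: "'a pair_pre_digraph \<Rightarrow> ('a \<Rightarrow> nat) \<Rightarrow> 'a set" where
  "bad_vertices G c =
     {v \<in> pverts G. 2 \<le> card (neighbors G v) \<and> (\<forall>a\<in>neighbors G v. \<forall>b\<in>neighbors G v. c a = c b)}"

lemma bad_vertices_cong:
  assumes "\<And>u. u \<in> neighbors G v \<Longrightarrow> c u = d u"
  shows "v \<in> bad_vertices G c \<longleftrightarrow> v \<in> bad_vertices G d"
  using assms by (simp add: bad_vertices_def)

lemma not_badI:
  assumes "a \<in> neighbors G v" "b \<in> neighbors G v" "c a \<noteq> c b"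
  shows "v \<notin> bad_vertices G c"
  using assms by (auto simp: bad_vertices_def)

lemma bad_verticesD:
  assumes "v \<in> bad_vertices G c"
  shows "v \<in> pverts G" "2 \<le> card (neighbors G v)"
    "\<And>a b. a \<in> neighbors G v \<Longrightarrow> b \<in> neighbors G v \<Longrightarrow> c a = c b"
  using assms unfolding bad_vertices_def by blast+

lemma ex_other_element:
  assumes "2 \<le> card A"
  obtains b where "b \<in> A" "b \<noteq> a"
proof -
  have "\<not> A \<subseteq> {a}"
    using assms card_mono[of "{a}" A] by auto
  then show thesis using that by blast
qed

context pair_graph
begin

lemma neighbors_sym: "u \<in> neighbors G v \<Longrightarrow> v \<in> neighbors G u"
  using arcs_symmetric by (auto simp: neighbors_def)

lemma neighbors_verts: "u \<in> neighbors G v \<Longrightarrow> u \<in> pverts G \<and> v \<in> pverts G"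
  by (auto simp: neighbors_def dest: in_arcsD1 in_arcsD2)

lemma neighbors_irrefl: "v \<notin> neighbors G v"
  using pair_no_loops[of "(v, v)"] by (auto simp: neighbors_def)

lemma finite_neighbors [simp]: "finite (neighbors G v)"
  using pair_finite_verts neighbors_verts by (meson finite_subset subsetI)

lemma out_degree_eq: "out_degree (with_proj G) v = card (neighbors G v)"
proof -
  have "out_arcs (with_proj G) v = Pair v ` neighbors G v"
    by (auto simp: out_arcs_def neighbors_def)
  then show ?thesis
    by (simp add: out_degree_def card_image inj_on_def)
qed

lemma proper_coloring_iff:
  "proper_coloring G l c \<longleftrightarrow>
     (\<forall>v\<in>pverts G. 1 \<le> c v \<and> c v \<le> l) \<and> (\<forall>v u. u \<in> neighbors G v \<longrightarrow> c u \<noteq> c v)"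
proof -
  have "(\<forall>(u, v)\<in>parcs G. c u \<noteq> c v) \<longleftrightarrow> (\<forall>v u. u \<in> neighbors G v \<longrightarrow> c u \<noteq> c v)"
    unfolding neighbors_def by (simp add: Ball_def) metis
  then show ?thesis unfolding proper_coloring_def by simp
qed

lemma proper_coloring_fun_upd:
  assumes c: "proper_coloring G l c" and i: "1 \<le> i" "i \<le> l"
    and free: "\<And>u. u \<in> neighbors G v \<Longrightarrow> c u \<noteq> i"
  shows "proper_coloring G l (c(v := i))"
  unfolding proper_coloring_iff
proof (intro conjI ballI allI impI)
  fix u w assume uw: "w \<in> neighbors G u"
  have "c w \<noteq> c u" using c uw by (auto simp: proper_coloring_iff)
  moreover have "c w \<noteq> i" if "u = v" using free uw that by simp
  moreover have "c u \<noteq> i" if "w = v" using free neighbors_sym[OF uw] that by simp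
  moreover have "u \<noteq> w" using uw neighbors_irrefl by blast
  ultimately show "(c(v := i)) w \<noteq> (c(v := i)) u" by auto
qed (use c i in \<open>auto simp: proper_coloring_iff\<close>)

lemma dynamic_coloring_iff:
  "dynamic_coloring G l c \<longleftrightarrow> proper_coloring G l c \<and> bad_vertices G c = {}"
proof -
  have "2 \<le> card (c ` neighbors G v) \<longleftrightarrow> (\<exists>a\<in>neighbors G v. \<exists>b\<in>neighbors G v. c a \<noteq> c b)" for v
  proof
    assume two: "2 \<le> card (c ` neighbors G v)"
    then obtain i where "i \<in> c ` neighbors G v" using ex_other_element by metis
    moreover obtain j where "j \<in> c ` neighbors G v" "j \<noteq> i" using ex_other_element[OF two] by metis
    ultimately show "\<exists>a\<in>neighbors G v. \<exists>b\<in>neighbors G v. c a \<noteq> c b" by auto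
  next
    assume "\<exists>a\<in>neighbors G v. \<exists>b\<in>neighbors G v. c a \<noteq> c b"
    then obtain a b where ab: "a \<in> neighbors G v" "b \<in> neighbors G v" "c a \<noteq> c b" by blast
    then have "card {c a, c b} \<le> card (c ` neighbors G v)" by (intro card_mono) auto
    then show "2 \<le> card (c ` neighbors G v)" using ab by simp
  qed
  then show ?thesis
    unfolding dynamic_coloring_def bad_vertices_def out_degree_eq by blast
qed

lemma finite_bad_vertices [simp]: "finite (bad_vertices G c)"
  using pair_finite_verts by (simp add: bad_vertices_def)

lemma independent_set_iff:
  "independent_set G S \<longleftrightarrow> S \<subseteq> pverts G \<and> (\<forall>u\<in>S. \<forall>v\<in>S. u \<notin> neighbors G v)"
  by (auto simp: independent_set_def neighbors_def)

text \<open>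
  The vertices of \<open>R\<close> receive new colors.  If \<open>e\<close> separates the old colors, the new coloring refines
  the old one, so it is proper and has no further bad vertices; it is enough that every bad vertex
  sees two colors afterwards.
\<close>
lemma dynamic_chromatic_number_le_split:
  fixes e :: "'a \<Rightarrow> nat"
  assumes c: "proper_coloring G l c"
    and range: "\<And>v. v \<in> R \<Longrightarrow> 1 \<le> e v \<and> e v \<le> m"
    and refines: "\<And>u v. u \<in> R \<Longrightarrow> v \<in> R \<Longrightarrow> e u = e v \<Longrightarrow> c u = c v"
    and repaired: "\<And>v. v \<in> bad_vertices G c \<Longrightarrow>
      \<exists>a\<in>neighbors G v. \<exists>b\<in>neighbors G v. a \<in> R \<and> (b \<in> R \<longrightarrow> e a \<noteq> e b)"
  shows "dynamic_chromatic_number G \<le> l + m"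
proof -
  define c' where "c' v = (if v \<in> R then l + e v else c v)" for v
  have c_range: "1 \<le> c v" "c v \<le> l" if "v \<in> pverts G" for v
    using c that by (auto simp: proper_coloring_iff)
  have c'_range: "1 \<le> c' v \<and> c' v \<le> l + m" if "v \<in> pverts G" for v
    using c_range[OF that] range[of v] by (auto simp: c'_def)
  have c'_new: "c' u \<noteq> c' v" if "u \<in> R" "v \<in> pverts G" "v \<notin> R" for u v
    using c_range[OF that(2)] range[OF that(1)] that by (simp add: c'_def)
  have c'_refines: "c u = c v" if "u \<in> pverts G" "v \<in> pverts G" "c' u = c' v" for u v
    using c'_new[of u v] c'_new[of v u] refines[of u v] that
    by (cases "u \<in> R"; cases "v \<in> R") (auto simp: c'_def)
  have "c' u \<noteq> c' v" if "u \<in> neighbors G v" for u v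
    using c c'_refines[of u v] neighbors_verts[OF that] that unfolding proper_coloring_iff by blast
  then have "proper_coloring G (l + m) c'"
    using c'_range by (simp add: proper_coloring_iff)
  moreover have "bad_vertices G c' = {}"
  proof (rule equals0I)
    fix v assume v: "v \<in> bad_vertices G c'"
    have "c a = c b" if "a \<in> neighbors G v" "b \<in> neighbors G v" for a b
      using c'_refines bad_verticesD(3)[OF v that] neighbors_verts that by blast
    then have "v \<in> bad_vertices G c"
      using bad_verticesD(1,2)[OF v] unfolding bad_vertices_def by blast
    then obtain a b where ab: "a \<in> neighbors G v" "b \<in> neighbors G v" "a \<in> R"
      "b \<in> R \<longrightarrow> e a \<noteq> e b"
      using repaired by blast
    then have "c' a \<noteq> c' b"
      using c'_new[of a b] neighbors_verts[OF ab(2)] by (cases "b \<in> R") (auto simp: c'_def)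
    then show False using not_badI[OF ab(1,2)] v by blast
  qed
  ultimately have "dynamic_coloring G (l + m) c'" by (simp add: dynamic_coloring_iff)
  then show ?thesis unfolding dynamic_chromatic_number_def by (auto intro: Least_le)
qed

section \<open>Colorings whose bad vertices are independent\<close>

text \<open>A coloring with the least sum of colors is greedy.\<close>
lemma ex_greedy_coloring:
  assumes "proper_coloring G l c0"
  obtains c where "proper_coloring G l c"
    "\<And>v i. v \<in> pverts G \<Longrightarrow> 1 \<le> i \<Longrightarrow> i < c v \<Longrightarrow> \<exists>u\<in>neighbors G v. c u = i"
proof -
  obtain c where c: "proper_coloring G l c"
    and min: "\<And>d. proper_coloring G l d \<Longrightarrow> sum c (pverts G) \<le> sum d (pverts G)"
    using ex_has_least_nat[of "proper_coloring G l" c0 "\<lambda>c. sum c (pverts G)"] assms by blast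
  show thesis
  proof (rule that[OF c], rule ccontr)
    fix v i
    assume v: "v \<in> pverts G" and i: "1 \<le> i" "i < c v" and no: "\<not> (\<exists>u\<in>neighbors G v. c u = i)"
    have "proper_coloring G l (c(v := i))"
      using i no v c by (intro proper_coloring_fun_upd) (auto simp: proper_coloring_iff)
    then have "sum c (pverts G) \<le> sum (c(v := i)) (pverts G)" by (rule min)
    moreover have "sum (c(v := i)) (pverts G) < sum c (pverts G)"
      using v i pair_finite_verts by (intro sum_strict_mono_ex1) auto
    ultimately show False by simp
  qed
qed

text \<open>
  Start with a greedy coloring.  Every vertex of color at least three sees the colors one and two
  and is therefore good, so adjacent bad vertices have the colors one and two, and the one of color
  one lies in the set \<open>X\<close> of bad vertices that have color one and see only color two.  The vertices
  \<open>x\<close> of \<open>X\<close> are treated one after the other.  If changing \<open>x\<close> to color three leaves all neighbours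
  of \<open>x\<close> good, this is done.  Otherwise all neighbours but \<open>x\<close> of some neighbour \<open>u\<close> of \<open>x\<close> have
  color three, and changing \<open>u\<close> to color four makes \<open>x\<close> good, because \<open>x\<close> now sees the colors two
  and four.  A vertex whose original color is at least three stays good throughout: it has a
  neighbour of color one, which is not in \<open>X\<close> and keeps its color, and a neighbour of color two,
  which never gets color one.
\<close>
lemma ex_coloring_independent_bad:
  assumes "proper_coloring G l c0" and l: "4 \<le> l"
  obtains d where "proper_coloring G l d" "independent_set G (bad_vertices G d)"
proof -
  obtain c where c: "proper_coloring G l c"
    and greedy: "\<And>v i. v \<in> pverts G \<Longrightarrow> 1 \<le> i \<Longrightarrow> i < c v \<Longrightarrow> \<exists>u\<in>neighbors G v. c u = i"
    using ex_greedy_coloring[OF assms(1)] by blast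
  have c_range: "1 \<le> c v" "c v \<le> l" if "v \<in> pverts G" for v
    using c that by (auto simp: proper_coloring_iff)
  have c_nb: "c u \<noteq> c v" if "u \<in> neighbors G v" for u v
    using c that by (auto simp: proper_coloring_iff)
  define X where "X = {x \<in> pverts G. c x = 1 \<and> 2 \<le> card (neighbors G x) \<and>
    (\<forall>u\<in>neighbors G x. c u = 2)}"
  have XD: "x \<in> pverts G" "c x = 1" "2 \<le> card (neighbors G x)"
    "\<And>u. u \<in> neighbors G x \<Longrightarrow> c u = 2" if "x \<in> X" for x
    using that by (auto simp: X_def)
  \<comment> \<open>the invariant when the vertices in \<open>P\<close> have been treated: only these and vertices of original
    color two have changed; a changed vertex of the latter kind is good, and its neighbours of
    original color one have been treated; a treated vertex is good itself if it kept color one, and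
    otherwise has only good neighbours\<close>
  define recolored where "recolored P d \<longleftrightarrow>
      proper_coloring G l d \<and>
      (\<forall>v\<in>pverts G. v \<notin> P \<longrightarrow> c v \<noteq> 2 \<longrightarrow> d v = c v) \<and>
      (\<forall>v\<in>pverts G. c v = 2 \<longrightarrow> d v \<noteq> 2 \<longrightarrow>
         d v \<noteq> 1 \<and> v \<notin> bad_vertices G d \<and> (\<forall>x\<in>neighbors G v. c x = 1 \<longrightarrow> x \<in> P)) \<and>
      (\<forall>x\<in>P. if d x = 1 then x \<notin> bad_vertices G d
         else \<forall>u\<in>neighbors G x. u \<notin> bad_vertices G d)" for P d
  have "finite X" using pair_finite_verts by (simp add: X_def)
  moreover have "\<exists>d. recolored P d" if "finite P" "P \<subseteq> X" for P
    using that
  proof (induction P rule: finite_subset_induct')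
    case empty
    have "recolored {} c" using c by (simp add: recolored_def)
    then show ?case by blast
  next
    case (insert x P)
    note x = \<open>x \<in> X\<close> and PX = \<open>P \<subseteq> X\<close> and xP = \<open>x \<notin> P\<close>
    obtain d where d: "recolored P d" using insert.IH by blast
    have d_proper: "proper_coloring G l d" using d by (simp add: recolored_def)
    have d_same: "d v = c v" if "v \<in> pverts G" "v \<notin> P" "c v \<noteq> 2" for v
      using d that by (auto simp: recolored_def)
    have d_two: "d v \<noteq> 1" "v \<notin> bad_vertices G d" "\<And>y. y \<in> neighbors G v \<Longrightarrow> c y = 1 \<Longrightarrow> y \<in> P"
      if "v \<in> pverts G" "c v = 2" "d v \<noteq> 2" for v
      using d that by (auto simp: recolored_def)
    have d_P: "if d y = 1 then y \<notin> bad_vertices G d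
        else \<forall>u\<in>neighbors G y. u \<notin> bad_vertices G d" if "y \<in> P" for y
      using d that by (auto simp: recolored_def)
    have dx: "d x = 1" using d_same[of x] XD[OF x] xP by simp
    have nb_x: "u \<in> pverts G" "c u = 2" "d u = 2" "x \<in> neighbors G u" if u: "u \<in> neighbors G x" for u
    proof -
      show "u \<in> pverts G" "x \<in> neighbors G u" using neighbors_verts neighbors_sym u by blast+
      show "c u = 2" using XD(4)[OF x u] .
      then show "d u = 2" using d_two(3)[of u x] XD(2)[OF x] xP
          \<open>u \<in> pverts G\<close> \<open>x \<in> neighbors G u\<close> by blast
    qed
    show ?case
    proof (cases "\<exists>u\<in>neighbors G x. neighbors G u \<noteq> {x} \<and> (\<forall>z\<in>neighbors G u - {x}. d z = 3)")
      case False
      define d' where "d' = d(x := 3)"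
      have away: "v \<in> bad_vertices G d' \<longleftrightarrow> v \<in> bad_vertices G d" if "x \<notin> neighbors G v" for v
        using that by (intro bad_vertices_cong) (auto simp: d'_def)
      have near: "u \<notin> bad_vertices G d'" if u: "u \<in> neighbors G x" for u
      proof (cases "neighbors G u = {x}")
        case True
        then show ?thesis by (auto simp: bad_vertices_def)
      next
        case nx: False
        then obtain z where "z \<in> neighbors G u" "z \<noteq> x" "d z \<noteq> 3" using False u by blast
        then show ?thesis using nb_x(4)[OF u] by (intro not_badI[of z _ u x]) (auto simp: d'_def)
      qed
      have "proper_coloring G l d'"
        unfolding d'_def using d_proper l nb_x(3) by (intro proper_coloring_fun_upd) auto
      moreover have "\<forall>v\<in>pverts G. v \<notin> insert x P \<longrightarrow> c v \<noteq> 2 \<longrightarrow> d' v = c v"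
        using d_same by (simp add: d'_def)
      moreover have "d' v \<noteq> 1 \<and> v \<notin> bad_vertices G d' \<and>
          (\<forall>y\<in>neighbors G v. c y = 1 \<longrightarrow> y \<in> insert x P)"
        if v: "v \<in> pverts G" "c v = 2" "d' v \<noteq> 2" for v
      proof -
        have "v \<noteq> x" using v XD(2)[OF x] by auto
        then have dv: "d' v = d v" by (simp add: d'_def)
        then have "x \<notin> neighbors G v" using d_two(3)[of v x] XD(2)[OF x] xP v by auto
        then show ?thesis using away d_two[of v] v dv by auto
      qed
      moreover have "if d' y = 1 then y \<notin> bad_vertices G d'
          else \<forall>u\<in>neighbors G y. u \<notin> bad_vertices G d'" if y: "y \<in> insert x P" for y
      proof (cases "y = x")
        case True
        then show ?thesis using near by (simp add: d'_def)
      next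
        case ne: False
        then have yP: "y \<in> P" using y by simp
        have "x \<notin> neighbors G y" using c_nb[of x y] XD(2)[OF x] XD(2)[of y] yP PX by auto
        moreover have "u \<notin> bad_vertices G d'" if "u \<notin> bad_vertices G d" for u
          using that away near neighbors_sym by blast
        moreover have "d' y = d y" using ne by (simp add: d'_def)
        ultimately show ?thesis using d_P[OF yP] away by auto
      qed
      ultimately have "recolored (insert x P) d'" unfolding recolored_def by blast
      then show ?thesis by blast
    next
      case True
      then obtain u where u: "u \<in> neighbors G x" and ne: "neighbors G u \<noteq> {x}"
        and three: "\<And>z. z \<in> neighbors G u \<Longrightarrow> z \<noteq> x \<Longrightarrow> d z = 3" by blast
      have ux: "x \<in> neighbors G u" using nb_x(4)[OF u] .
      obtain z where z: "z \<in> neighbors G u" "z \<noteq> x" using ne ux by blast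
      define d' where "d' = d(u := 4)"
      have away: "v \<in> bad_vertices G d' \<longleftrightarrow> v \<in> bad_vertices G d" if "u \<notin> neighbors G v" for v
        using that by (intro bad_vertices_cong) (auto simp: d'_def)
      have two_away: "u \<notin> neighbors G v" if "c v = 2" for v
        using c_nb[of u v] nb_x(2)[OF u] that by auto
      have u_good: "u \<notin> bad_vertices G d'"
        using z ux dx three[OF z] neighbors_irrefl[of u]
        by (intro not_badI[of z _ u x]) (auto simp: d'_def)
      have x_good: "x \<notin> bad_vertices G d'"
      proof -
        obtain w where "w \<in> neighbors G x" "w \<noteq> u" using ex_other_element[OF XD(3)[OF x]] by blast
        then show ?thesis using nb_x(3)[of w] u by (intro not_badI[of w _ x u]) (auto simp: d'_def)
      qed
      have "d w \<noteq> 4" if "w \<in> neighbors G u" for w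
        using three[OF that] dx by (cases "w = x") auto
      then have "proper_coloring G l d'"
        unfolding d'_def using d_proper l by (intro proper_coloring_fun_upd) auto
      moreover have "\<forall>v\<in>pverts G. v \<notin> insert x P \<longrightarrow> c v \<noteq> 2 \<longrightarrow> d' v = c v"
        using d_same nb_x(2)[OF u] by (auto simp: d'_def)
      moreover have "d' v \<noteq> 1 \<and> v \<notin> bad_vertices G d' \<and>
          (\<forall>y\<in>neighbors G v. c y = 1 \<longrightarrow> y \<in> insert x P)"
        if v: "v \<in> pverts G" "c v = 2" "d' v \<noteq> 2" for v
      proof (cases "v = u")
        case True
        have "y \<in> insert x P" if y: "y \<in> neighbors G u" "c y = 1" for y
          using three[OF y(1)] d_same[of y] y neighbors_verts[OF y(1)] by fastforce
        then show ?thesis using True u_good by (auto simp: d'_def)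
      next
        case False
        then show ?thesis using d_two[of v] v away[OF two_away[OF v(2)]] by (auto simp: d'_def)
      qed
      moreover have "if d' y = 1 then y \<notin> bad_vertices G d'
          else \<forall>w\<in>neighbors G y. w \<notin> bad_vertices G d'" if y: "y \<in> insert x P" for y
      proof (cases "y = x")
        case True
        then show ?thesis using x_good dx c_nb[OF u] by (auto simp: d'_def)
      next
        case False
        then have yP: "y \<in> P" using y by simp
        have yX: "y \<in> X" using yP PX by blast
        have yu: "y \<noteq> u" using XD(2)[OF yX] nb_x(2)[OF u] by auto
        have "u \<notin> neighbors G y" if "d y = 1"
          using three[of y] that False neighbors_sym[of u y] by auto
        moreover have "u \<notin> neighbors G w" if "w \<in> neighbors G y" for w
          using two_away XD(4)[OF yX that] by blast
        moreover have "d' y = d y" using yu by (simp add: d'_def)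
        ultimately show ?thesis using d_P[OF yP] away by metis
      qed
      ultimately have "recolored (insert x P) d'" unfolding recolored_def by blast
      then show ?thesis by blast
    qed
  qed
  ultimately obtain d where d: "recolored X d" by blast
  have d_proper: "proper_coloring G l d" using d by (simp add: recolored_def)
  have d_same: "d v = c v" if "v \<in> pverts G" "v \<notin> X" "c v \<noteq> 2" for v
    using d that by (auto simp: recolored_def)
  have d_two: "d v \<noteq> 1" "d v \<noteq> 2 \<Longrightarrow> v \<notin> bad_vertices G d" if "v \<in> pverts G" "c v = 2" for v
  proof -
    have "d v \<noteq> 2 \<Longrightarrow> d v \<noteq> 1 \<and> v \<notin> bad_vertices G d"
      using d that unfolding recolored_def by blast
    then show "d v \<noteq> 1" "d v \<noteq> 2 \<Longrightarrow> v \<notin> bad_vertices G d" by auto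
  qed
  have d_X: "if d x = 1 then x \<notin> bad_vertices G d
        else \<forall>u\<in>neighbors G x. u \<notin> bad_vertices G d" if "x \<in> X" for x
    using d that by (auto simp: recolored_def)
  have high_good: "v \<notin> bad_vertices G d" if v: "v \<in> pverts G" "3 \<le> c v" for v
  proof -
    obtain p q where p: "p \<in> neighbors G v" "c p = 1" and q: "q \<in> neighbors G v" "c q = 2"
      using greedy[of v 1] greedy[of v 2] v by auto
    have "p \<notin> X" using XD(4)[of p v] neighbors_sym[OF p(1)] v by auto
    then have "d p = 1" using d_same[of p] p neighbors_verts[OF p(1)] by auto
    moreover have "d q \<noteq> 1" using d_two(1)[of q] q neighbors_verts[OF q(1)] by auto
    ultimately show ?thesis using p q by (intro not_badI[of p _ v q]) auto
  qed
  have low_not_adjacent: False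
    if v: "v \<in> bad_vertices G d" "c v = 1" and u: "u \<in> bad_vertices G d" "c u = 2"
      and uv: "u \<in> neighbors G v" for u v
  proof (cases "v \<in> X")
    case True
    then show ?thesis using d_X[OF True] v u uv by (auto split: if_splits)
  next
    case False
    have vV: "v \<in> pverts G" and uV: "u \<in> pverts G" using neighbors_verts[OF uv] by auto
    have du: "d u = 2" using d_two(2)[OF uV u(2)] u(1) by blast
    have "c w = 2" if w: "w \<in> neighbors G v" for w
    proof (rule ccontr)
      assume w2: "c w \<noteq> 2"
      have wV: "w \<in> pverts G" using neighbors_verts[OF w] by simp
      have "w \<notin> X" using c_nb[OF w] v(2) XD(2) by auto
      then have "d w = c w" using d_same[OF wV] w2 by simp
      then show False using bad_verticesD(3)[OF v(1) w uv] du w2 by simp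
    qed
    then have "v \<in> X" using v(2) vV bad_verticesD(2)[OF v(1)] by (simp add: X_def)
    then show ?thesis using False by simp
  qed
  have "independent_set G (bad_vertices G d)"
    unfolding independent_set_iff
  proof (intro conjI ballI notI)
    show "bad_vertices G d \<subseteq> pverts G" by (auto simp: bad_vertices_def)
    fix u v assume uv: "u \<in> bad_vertices G d" "v \<in> bad_vertices G d" "u \<in> neighbors G v"
    have low: "c w = 1 \<or> c w = 2" if "w \<in> bad_vertices G d" for w
      using high_good[of w] c_range(1)[of w] bad_verticesD(1)[OF that] that by linarith
    have "c u \<noteq> c v" by (rule c_nb[OF uv(3)])
    then show False using low[OF uv(1)] low[OF uv(2)] uv low_not_adjacent[of v u]
        low_not_adjacent[of u v] neighbors_sym[OF uv(3)] by auto
  qed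
  then show thesis using that d_proper by blast
qed

text \<open>Distinct new colors for one neighbour of each bad vertex repair the coloring.\<close>
lemma dynamic_chromatic_number_le_bad:
  assumes c: "proper_coloring G l c"
  shows "dynamic_chromatic_number G \<le> l + card (bad_vertices G c)"
proof -
  let ?B = "bad_vertices G c"
  have "\<exists>u. u \<in> neighbors G v" if "v \<in> ?B" for v
    using ex_other_element[OF bad_verticesD(2)[OF that]] by blast
  then obtain s where s: "\<And>v. v \<in> ?B \<Longrightarrow> s v \<in> neighbors G v" by metis
  have "finite (s ` ?B)" by simp
  then obtain e where e: "bij_betw e (s ` ?B) {1..card (s ` ?B)}"
    using finite_same_card_bij[of "s ` ?B" "{1..card (s ` ?B)}"] by auto
  have inj: "u = v" if "u \<in> s ` ?B" "v \<in> s ` ?B" "e u = e v" for u v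
    using inj_onD[OF bij_betw_imp_inj_on[OF e] that(3,1,2)] .
  have "dynamic_chromatic_number G \<le> l + card (s ` ?B)"
  proof (rule dynamic_chromatic_number_le_split[OF c])
    show "1 \<le> e v \<and> e v \<le> card (s ` ?B)" if "v \<in> s ` ?B" for v
      using bspec[OF bij_betwE[OF e] that] by simp
    show "c u = c v" if "u \<in> s ` ?B" "v \<in> s ` ?B" "e u = e v" for u v
      using inj[OF that] by simp
    fix v assume v: "v \<in> ?B"
    obtain b where "b \<in> neighbors G v" "b \<noteq> s v"
      using ex_other_element[OF bad_verticesD(2)[OF v]] by blast
    then show "\<exists>a\<in>neighbors G v. \<exists>b\<in>neighbors G v. a \<in> s ` ?B \<and> (b \<in> s ` ?B \<longrightarrow> e a \<noteq> e b)"
      using s[OF v] v inj by blast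
  qed
  also have "card (s ` ?B) \<le> card ?B" by (rule card_image_le) simp
  finally show ?thesis by simp
qed

end

section \<open>Two-colorings of set systems\<close>

text \<open>Fewer homogeneous linear equations than unknowns have a nonzero solution.\<close>
lemma homogeneous_system_nonzero_solution:
  fixes a :: "'b \<Rightarrow> 'a \<Rightarrow> 'c::field"
  assumes "finite A" "finite V" "card A < card V"
  shows "\<exists>y. (\<exists>x\<in>V. y x \<noteq> 0) \<and> (\<forall>i\<in>A. (\<Sum>x\<in>V. a i x * y x) = 0)"
  using assms
proof (induction A arbitrary: V a rule: finite_induct)
  case empty
  then obtain x where "x \<in> V" by fastforce
  then show ?case by (intro exI[of _ "\<lambda>_. 1"]) auto
next
  case (insert i A)
  show ?case
  proof (cases "\<forall>x\<in>V. a i x = 0")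
    case True
    have "card A < card V" using insert by simp
    then obtain y where "\<exists>x\<in>V. y x \<noteq> 0" "\<forall>j\<in>A. (\<Sum>x\<in>V. a j x * y x) = 0"
      using insert.IH[OF insert.prems(1), of a] by blast
    then show ?thesis using True by (intro exI[of _ y]) simp
  next
    case False
    then obtain p where p: "p \<in> V" "a i p \<noteq> 0" by blast
    let ?V = "V - {p}"
    let ?a = "\<lambda>j x. a j x - a j p * a i x / a i p"
    have "card A < card ?V" using insert p by simp
    then obtain y where y: "\<exists>x\<in>?V. y x \<noteq> 0" "\<forall>j\<in>A. (\<Sum>x\<in>?V. ?a j x * y x) = 0"
      using insert.IH[of ?V ?a] insert.prems(1) by blast
    \<comment> \<open>the value at the pivot \<open>p\<close> solves equation \<open>i\<close>\<close>
    define t where "t = - (\<Sum>x\<in>?V. a i x * y x) / a i p"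
    have total: "(\<Sum>x\<in>V. a j x * (y(p := t)) x) = a j p * t + (\<Sum>x\<in>?V. a j x * y x)" for j
      using insert.prems(1) p(1) by (simp add: sum.remove cong: sum.cong_simp)
    have "(\<Sum>x\<in>V. a j x * (y(p := t)) x) = 0" if "j \<in> insert i A" for j
    proof (cases "j = i")
      case True
      then show ?thesis unfolding total using p by (simp add: t_def)
    next
      case False
      then have "0 = (\<Sum>x\<in>?V. ?a j x * y x)" using y(2) that by simp
      also have "\<dots> = (\<Sum>x\<in>?V. a j x * y x - a j p / a i p * (a i x * y x))"
        by (intro sum.cong) (auto simp: algebra_simps)
      also have "\<dots> = (\<Sum>x\<in>?V. a j x * y x) + a j p * t"
        unfolding sum_subtractf sum_distrib_left[symmetric] by (simp add: t_def)
      finally show ?thesis unfolding total by (simp add: add.commute)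
    qed
    moreover have "\<exists>x\<in>V. (y(p := t)) x \<noteq> 0" using y(1) by auto
    ultimately show ?thesis by blast
  qed
qed

text \<open>
  Seymour's criterion: a family of sets each of whose nonempty subfamilies has more points than
  members can be two-colored without monochromatic member.  The incidence matrix has a nonzero
  vector \<open>y\<close> in its kernel.  On a member where \<open>y\<close> does not vanish identically, \<open>y\<close> takes both
  signs; the other members form a smaller family, whose points lie in the zero set of \<open>y\<close>.
\<close>
lemma ex_two_coloring:
  fixes N :: "'b \<Rightarrow> 'a set"
  assumes "finite B" and "\<And>b. b \<in> B \<Longrightarrow> finite (N b)"
    and "\<And>B'. B' \<subseteq> B \<Longrightarrow> B' \<noteq> {} \<Longrightarrow> card B' < card (\<Union>(N ` B'))"
  shows "\<exists>f. \<forall>b\<in>B. (\<exists>x\<in>N b. f x) \<and> (\<exists>x\<in>N b. \<not> f x)"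
  using assms
proof (induction B rule: finite_psubset_induct)
  case (psubset B)
  show ?case
  proof (cases "B = {}")
    case False
    let ?V = "\<Union>(N ` B)"
    have fin: "finite ?V" using psubset by auto
    then obtain y where y: "\<exists>x\<in>?V. y x \<noteq> 0"
      and ker: "\<forall>b\<in>B. (\<Sum>x\<in>?V. (if x \<in> N b then 1 else 0) * y x) = (0::real)"
      using homogeneous_system_nonzero_solution[of B ?V "\<lambda>b x. if x \<in> N b then 1 else 0"]
        psubset.hyps psubset.prems(2)[OF subset_refl False] by blast
    have zero: "(\<Sum>x\<in>N b. y x) = 0" if "b \<in> B" for b
    proof -
      have "(\<Sum>x\<in>N b. y x) = (\<Sum>x\<in>?V. if x \<in> N b then y x else 0)"
        using fin that by (simp add: sum.If_cases Int_absorb1 UN_upper)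
      also have "\<dots> = (\<Sum>x\<in>?V. (if x \<in> N b then 1 else 0) * y x)"
        by (intro sum.cong) auto
      finally show ?thesis using ker that by simp
    qed
    define Z where "Z = {b \<in> B. \<forall>x\<in>N b. y x = 0}"
    have "Z \<subset> B" using y by (auto simp: Z_def)
    then obtain g where g: "\<forall>b\<in>Z. (\<exists>x\<in>N b. g x) \<and> (\<exists>x\<in>N b. \<not> g x)"
      using psubset.IH[of Z] psubset.prems
      by (metis (full_types) psubset_imp_subset subsetD subset_trans)
    define f where "f x = (if y x = 0 then g x else y x > 0)" for x
    have "(\<exists>x\<in>N b. f x) \<and> (\<exists>x\<in>N b. \<not> f x)" if b: "b \<in> B" for b
    proof (cases "b \<in> Z")
      case True
      then have "f x = g x" if "x \<in> N b" for x using that by (simp add: Z_def f_def)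
      then show ?thesis using g True by blast
    next
      case False
      then have nz: "\<exists>x\<in>N b. y x \<noteq> 0" using b by (simp add: Z_def)
      have "\<exists>x\<in>N b. y x > 0"
      proof (rule ccontr)
        assume "\<not> (\<exists>x\<in>N b. y x > 0)"
        then have "\<forall>x\<in>N b. y x = 0"
          using sum_nonneg_eq_0_iff[of "N b" "\<lambda>x. - y x"] zero[OF b] psubset.prems(1)[OF b]
            by (force simp: sum_negf not_less)
        then show False using nz by blast
      qed
      moreover have "\<exists>x\<in>N b. y x < 0"
      proof (rule ccontr)
        assume "\<not> (\<exists>x\<in>N b. y x < 0)"
        then have "\<forall>x\<in>N b. y x = 0"
          using sum_nonneg_eq_0_iff[of "N b" y] zero[OF b] psubset.prems(1)[OF b]
            by (force simp: not_less)
        then show False using nz by blast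
      qed
      ultimately show ?thesis unfolding f_def by (metis less_irrefl less_asym)
    qed
    then show ?thesis by blast
  qed simp
qed

section \<open>Regular graphs\<close>

context pair_graph
begin

text \<open>
  Double counting of the edges between \<open>A\<close> and its neighbourhood: the neighbourhood is at least as
  large as \<open>A\<close>, and in the case of equality no edge leaves the union of the two.
\<close>
lemma regular_neighborhood:
  assumes reg: "\<And>v. v \<in> pverts G \<Longrightarrow> card (neighbors G v) = k" and k: "0 < k"
    and A: "A \<subseteq> pverts G"
  shows "card A \<le> card (\<Union>(neighbors G ` A))"
    and "card (\<Union>(neighbors G ` A)) \<le> card A \<Longrightarrow> x \<in> \<Union>(neighbors G ` A) \<Longrightarrow> neighbors G x \<subseteq> A"
proof -
  let ?W = "\<Union>(neighbors G ` A)"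
  have W: "?W \<subseteq> pverts G" using neighbors_verts by blast
  have fin: "finite A" "finite ?W" using A W pair_finite_verts finite_subset by blast+
  have count: "card (Sigma S (neighbors G)) = k * card S" if "S \<subseteq> pverts G" for S
  proof -
    have "card (Sigma S (neighbors G)) = (\<Sum>v\<in>S. card (neighbors G v))"
      using finite_subset[OF that pair_finite_verts] by (intro card_SigmaI) auto
    also have "\<dots> = (\<Sum>v\<in>S. k)" using that reg by (intro sum.cong) auto
    finally show ?thesis by simp
  qed
  let ?E = "prod.swap ` Sigma A (neighbors G)"
  have E: "?E \<subseteq> Sigma ?W (neighbors G)" using neighbors_sym by auto
  have finE: "finite (Sigma ?W (neighbors G))" using fin(2) by (intro finite_SigmaI) auto
  have cardE: "card ?E = k * card A" by (simp add: card_image count[OF A])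
  show "card A \<le> card ?W"
    using card_mono[OF finE E] k unfolding cardE count[OF W] by simp
  assume "card ?W \<le> card A" and x: "x \<in> ?W"
  then have EW: "?E = Sigma ?W (neighbors G)"
    using card_seteq[OF finE E] unfolding cardE count[OF W] by simp
  show "neighbors G x \<subseteq> A"
  proof
    fix y assume "y \<in> neighbors G x"
    then have "(x, y) \<in> ?E" unfolding EW using x by blast
    then show "y \<in> A" by auto
  qed
qed

text \<open>
  If some set of bad vertices violates the strict inequality, then a minimal such set \<open>A\<close> and its
  neighbourhood \<open>W\<close> have equal size, and no edge leaves \<open>A \<union> W\<close>.  For \<open>y0\<close> in \<open>W\<close>,
  minimality of \<open>A\<close> and Seymour's criterion give a coloring of \<open>A\<close> with the colors one and three
  for which all vertices of \<open>W\<close> except possibly \<open>y0\<close> are good.  Color four for \<open>y0\<close> and color two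
  for the rest of \<open>W\<close> make the neighbours of \<open>y0\<close> good.  There are at least two of them, and at most
  \<open>y0\<close> becomes bad, so the number of bad vertices drops.
\<close>
lemma minimal_bad_expansion:
  assumes reg: "\<And>v. v \<in> pverts G \<Longrightarrow> card (neighbors G v) = k"
    and l: "4 \<le> l" and c: "proper_coloring G l c" and ind: "independent_set G (bad_vertices G c)"
    and least: "\<And>d. proper_coloring G l d \<Longrightarrow> independent_set G (bad_vertices G d) \<Longrightarrow>
      card (bad_vertices G c) \<le> card (bad_vertices G d)"
    and B': "B' \<subseteq> bad_vertices G c" "B' \<noteq> {}"
  shows "card B' < card (\<Union>(neighbors G ` B'))"
proof (rule ccontr)
  let ?B = "bad_vertices G c"
  let ?tight = "\<lambda>A. A \<subseteq> ?B \<and> A \<noteq> {} \<and> card (\<Union>(neighbors G ` A)) \<le> card A"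
  assume "\<not> card B' < card (\<Union>(neighbors G ` B'))"
  then have "?tight B'" using B' by simp
  then obtain A where "?tight A" and minimal: "\<And>A'. ?tight A' \<Longrightarrow> card A \<le> card A'"
    using ex_has_least_nat[of ?tight B' card] by blast
  then have AB: "A \<subseteq> ?B" and "A \<noteq> {}" and tight: "card (\<Union>(neighbors G ` A)) \<le> card A" by auto
  then obtain a0 where a0: "a0 \<in> A" by blast
  have BV: "?B \<subseteq> pverts G" by (auto simp: bad_vertices_def)
  have AV: "A \<subseteq> pverts G" using AB BV by blast
  have finA: "finite A" using AB finite_bad_vertices finite_subset by blast
  have k: "2 \<le> k" using reg[of a0] bad_verticesD(2)[of a0 G c] a0 AB AV by auto
  have k0: "0 < k" using k by simp
  define W where "W = \<Union>(neighbors G ` A)"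
  have WV: "W \<subseteq> pverts G" unfolding W_def using neighbors_verts by blast
  have NA: "neighbors G v \<subseteq> W" if "v \<in> A" for v using that by (auto simp: W_def)
  have NW: "neighbors G v \<subseteq> A" if "v \<in> W" for v
    using regular_neighborhood(2)[OF reg k0 AV tight] that unfolding W_def by blast
  have disj: "v \<notin> A" if "v \<in> W" for v
    using that ind AB unfolding W_def independent_set_iff by blast
  obtain y0 where y0: "y0 \<in> W" using ex_other_element[of "neighbors G a0"] NA[OF a0] reg k a0 AV
    by (metis subsetD)
  \<comment> \<open>otherwise the neighbourhood of \<open>W'\<close> would violate the strict inequality too, and by minimality
    of \<open>A\<close> it would be all of \<open>A\<close>, although no edge joins it to \<open>y0\<close>\<close>
  have "card W' < card (\<Union>(neighbors G ` W'))" if W': "W' \<subseteq> W - {y0}" "W' \<noteq> {}" for W'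
  proof (rule ccontr)
    let ?A' = "\<Union>(neighbors G ` W')"
    assume "\<not> card W' < card ?A'"
    then have small: "card ?A' \<le> card W'" by simp
    have W'V: "W' \<subseteq> pverts G" using W' WV by blast
    have A'A: "?A' \<subseteq> A" using W' NW by blast
    have inside: "neighbors G v \<subseteq> W'" if "v \<in> ?A'" for v
      using regular_neighborhood(2)[OF reg k0 W'V small that] by simp
    obtain w where w: "w \<in> W'" using W' by blast
    have "card (\<Union>(neighbors G ` ?A')) \<le> card W'"
      using inside W'V pair_finite_verts finite_subset by (intro card_mono) blast+
    also have "\<dots> \<le> card ?A'" by (rule regular_neighborhood(1)[OF reg k0 W'V])
    finally have "card (\<Union>(neighbors G ` ?A')) \<le> card ?A'" .
    moreover have "?A' \<noteq> {}"
    proof -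
      have "2 \<le> card (neighbors G w)" using reg[of w] w W'V k by auto
      then show ?thesis using w ex_other_element[of "neighbors G w"] by blast
    qed
    ultimately have "card A \<le> card ?A'" using A'A AB by (intro minimal) blast
    then have "?A' = A" using card_seteq[OF finA A'A] by blast
    then have "y0 \<in> W'" using y0 inside unfolding W_def by blast
    then show False using W' by blast
  qed
  moreover have "finite (W - {y0})" using WV pair_finite_verts finite_subset by blast
  ultimately obtain f where f: "\<And>v. v \<in> W - {y0} \<Longrightarrow>
      (\<exists>x\<in>neighbors G v. f x) \<and> (\<exists>x\<in>neighbors G v. \<not> f x)"
    using ex_two_coloring[of "W - {y0}" "neighbors G"] by (metis finite_neighbors)
  define d where "d v = (if v = y0 then 4 else if v \<in> W then 2
    else if v \<in> A then (if f v then 1 else 3) else c v)" for v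
  have dW: "d v = 2 \<or> d v = 4" if "v \<in> W" for v using that by (simp add: d_def)
  have dA: "d v = (if f v then 1 else 3)" if "v \<in> A" for v using that disj y0 by (auto simp: d_def)
  have dc: "d v = c v" if "v \<notin> W" "v \<notin> A" for v using that y0 by (auto simp: d_def)
  have outside: "u \<notin> W \<and> u \<notin> A" if "u \<in> neighbors G v" "v \<notin> W" "v \<notin> A" for u v
    using that NA NW neighbors_sym[OF that(1)] by blast
  have "d u \<noteq> d v" if uv: "u \<in> neighbors G v" for u v
  proof -
    consider "v \<in> W" "u \<in> A" | "v \<in> A" "u \<in> W" | "v \<notin> W" "v \<notin> A"
      using NA NW uv by blast
    then show ?thesis
    proof cases
      case 1 then show ?thesis using dW[of v] dA[of u] by auto
    next
      case 2 then show ?thesis using dW[of u] dA[of v] by auto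
    next
      case 3 then show ?thesis
        using dc[of v] dc[of u] outside[OF uv 3] c uv by (auto simp: proper_coloring_iff)
    qed
  qed
  moreover have "1 \<le> d v \<and> d v \<le> l" if "v \<in> pverts G" for v
    using c l that by (auto simp: d_def proper_coloring_iff)
  ultimately have d_proper: "proper_coloring G l d" by (simp add: proper_coloring_iff)
  have bad_d: "bad_vertices G d \<subseteq> insert y0 (?B - neighbors G y0)"
  proof
    fix v assume v: "v \<in> bad_vertices G d"
    consider "v = y0" | "v \<in> W - {y0}" | "v \<in> A" | "v \<notin> W" "v \<notin> A" by blast
    then show "v \<in> insert y0 (?B - neighbors G y0)"
    proof cases
      case 2
      then obtain p q where pq: "p \<in> neighbors G v" "f p" "q \<in> neighbors G v" "\<not> f q"
        using f by blast
      then have "d p = 1" "d q = 3" using dA NW[of v] 2 by auto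
      then show ?thesis using bad_verticesD(3)[OF v pq(1,3)] by simp
    next
      case 3
      have "v \<notin> neighbors G y0"
      proof
        assume "v \<in> neighbors G y0"
        then have "y0 \<in> neighbors G v" by (rule neighbors_sym)
        moreover obtain w where w: "w \<in> neighbors G v" "w \<noteq> y0"
          using ex_other_element[OF bad_verticesD(2)[OF v]] by blast
        moreover have "d w = 2" "d y0 = 4" using w NA[OF 3] by (auto simp: d_def)
        ultimately show False using bad_verticesD(3)[OF v, of w y0] by simp
      qed
      then show ?thesis using 3 AB by blast
    next
      case 4
      have "v \<in> ?B \<longleftrightarrow> v \<in> bad_vertices G d"
      proof (rule bad_vertices_cong)
        fix u assume "u \<in> neighbors G v"
        then show "c u = d u" using dc[of u] outside[of u v] 4 by simp
      qed
      then show ?thesis using v 4 NW[OF y0] by blast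
    qed simp
  qed
  have "independent_set G (insert y0 (?B - neighbors G y0))"
    unfolding independent_set_iff
  proof (intro conjI ballI)
    show "insert y0 (?B - neighbors G y0) \<subseteq> pverts G" using y0 WV BV by blast
    fix u v assume "u \<in> insert y0 (?B - neighbors G y0)" "v \<in> insert y0 (?B - neighbors G y0)"
    then show "u \<notin> neighbors G v"
      using ind neighbors_irrefl neighbors_sym[of u v] unfolding independent_set_iff by blast
  qed
  then have "independent_set G (bad_vertices G d)"
    using bad_d unfolding independent_set_iff by blast
  then have "card ?B \<le> card (bad_vertices G d)" by (rule least[OF d_proper])
  also have "\<dots> \<le> card (insert y0 (?B - neighbors G y0))" by (rule card_mono[OF _ bad_d]) simp
  also have "\<dots> \<le> Suc (card (?B - neighbors G y0))" by (rule card_insert_le_m1) simp_all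
  also have "card (?B - neighbors G y0) = card ?B - k"
    using reg[of y0] y0 WV NW[OF y0] AB by (subst card_Diff_subset) auto
  finally have "card ?B \<le> Suc (card ?B - k)" .
  moreover have "k \<le> card ?B"
    using card_mono[of ?B "neighbors G y0"] reg[of y0] y0 WV NW[OF y0] AB by auto
  ultimately show False using k by simp
qed

section \<open>Independent sets in the square\<close>

lemma graph_dist_le_2D:
  assumes "graph_dist G u v \<le> 2"
  shows "u = v \<or> v \<in> neighbors G u \<or> (\<exists>w. w \<in> neighbors G u \<and> w \<in> neighbors G v)"
proof -
  have cost: "awalk_cost (\<lambda>_. 1) p = real (length p)" for p :: "('a \<times> 'a) list"
    by (induction p) auto
  have "(INF p\<in>{p. awalk u p v}. ereal (awalk_cost (\<lambda>_. 1) p)) < 3"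
    using assms unfolding graph_dist_def \<mu>_def by (rule le_less_trans) simp
  then obtain p where p: "awalk u p v" and "ereal (awalk_cost (\<lambda>_. 1) p) < 3"
    by (auto simp: INF_less_iff)
  then have "length p < 3" by (simp add: cost)
  then consider "p = []" | e where "p = [e]" | e e' where "p = [e, e']"
    by (cases p; cases "tl p"; cases "tl (tl p)") auto
  then show ?thesis
  proof cases
    case 1
    then show ?thesis using p by (simp add: awalk_def)
  next
    case (2 e)
    then show ?thesis using p by (cases e) (auto simp: awalk_def neighbors_def)
  next
    case (3 e e')
    then have "fst e' \<in> neighbors G u" "v \<in> neighbors G (fst e')"
      using p by (cases e; cases e'; auto simp: awalk_def neighbors_def)+
    then show ?thesis using neighbors_sym by blast
  qed
qed

lemma card_le_independence_number:
  assumes "finite (pverts H)" "independent_set H S"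
  shows "card S \<le> independence_number H"
  unfolding independence_number_def
  using assms finite_independent_set_cards(1)[OF assms(1)] by (intro Max_ge) auto

text \<open>
  One new color for each color that is the color of a monochromatic neighbourhood.  Bad vertices
  representing different such colors have disjoint neighbourhoods and are not adjacent.
\<close>
lemma dynamic_chromatic_number_le_square:
  assumes c: "proper_coloring G l c" and ind: "independent_set G (bad_vertices G c)"
    and f: "\<And>v. v \<in> bad_vertices G c \<Longrightarrow>
      (\<exists>x\<in>neighbors G v. f x) \<and> (\<exists>x\<in>neighbors G v. \<not> f x)"
  shows "dynamic_chromatic_number G \<le> l + independence_number (graph_square G)"
proof -
  let ?B = "bad_vertices G c"
  define J where "J = (\<Union>v\<in>?B. c ` neighbors G v)"
  have finJ: "finite J" by (simp add: J_def)
  then obtain h where h: "bij_betw h J {1..card J}"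
    using finite_same_card_bij[of J "{1..card J}"] by auto
  have "dynamic_chromatic_number G \<le> l + card J"
  proof (rule dynamic_chromatic_number_le_split[OF c])
    let ?R = "{v. f v \<and> c v \<in> J}"
    show "1 \<le> h (c v) \<and> h (c v) \<le> card J" if "v \<in> ?R" for v
      using bij_betwE[OF h] that by simp
    show "c u = c v" if "u \<in> ?R" "v \<in> ?R" "h (c u) = h (c v)" for u v
      using bij_betw_imp_inj_on[OF h] that by (auto dest: inj_onD)
    fix v assume v: "v \<in> ?B"
    then show "\<exists>a\<in>neighbors G v. \<exists>b\<in>neighbors G v. a \<in> ?R \<and> (b \<in> ?R \<longrightarrow> h (c a) \<noteq> h (c b))"
      using f[OF v] unfolding J_def by blast
  qed
  also have "card J \<le> independence_number (graph_square G)"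
  proof -
    have "\<forall>i\<in>J. \<exists>v. v \<in> ?B \<and> i \<in> c ` neighbors G v" unfolding J_def by blast
    then obtain r where r: "\<And>i. i \<in> J \<Longrightarrow> r i \<in> ?B" "\<And>i. i \<in> J \<Longrightarrow> i \<in> c ` neighbors G (r i)"
      by metis
    have r_color: "c u = i" if "i \<in> J" "u \<in> neighbors G (r i)" for i u
      using bad_verticesD(3)[OF r(1)[OF that(1)] that(2)] r(2)[OF that(1)] by auto
    have "inj_on r J"
    proof (rule inj_onI)
      fix i j assume "i \<in> J" "j \<in> J" "r i = r j"
      then show "i = j" using r(2)[of i] r_color[of i] r_color[of j] by auto
    qed
    then have "card J = card (r ` J)" by (simp add: card_image)
    also have "\<dots> \<le> independence_number (graph_square G)"
    proof (rule card_le_independence_number)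
      show "finite (pverts (graph_square G))"
        using pair_finite_verts by (simp add: graph_square_def)
      have "False" if i: "i \<in> J" and j: "j \<in> J" and ne: "r i \<noteq> r j"
        and near: "graph_dist G (r i) (r j) \<le> 2" for i j
      proof -
        have "r j \<notin> neighbors G (r i)"
          using ind r(1)[OF i] r(1)[OF j] unfolding independent_set_iff by blast
        then obtain w where "w \<in> neighbors G (r i)" "w \<in> neighbors G (r j)"
          using graph_dist_le_2D[OF near] ne by blast
        then have "i = j" using r_color i j by blast
        then show False using ne by simp
      qed
      moreover have "r ` J \<subseteq> pverts G" using r(1) bad_verticesD(1)[of _ G c] by blast
      ultimately show "independent_set (graph_square G) (r ` J)"
        unfolding independent_set_def graph_square_def by auto
    qed
    finally show ?thesis .
  qed
  finally show ?thesis by simp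
qed

end

theorem theorem2:
  fixes G :: "'a pair_pre_digraph"
  assumes "pair_graph G"
    and "chromatic_number G \<ge> 4"
  shows "dynamic_chromatic_number G \<le> chromatic_number G + independence_number G
    \<and> (\<forall>k. regular_graph k G \<longrightarrow>
          dynamic_chromatic_number G
            \<le> chromatic_number G + independence_number (graph_square G))"
proof -
  interpret pair_graph G by fact
  let ?\<chi> = "chromatic_number G"
  let ?good = "\<lambda>c. proper_coloring G ?\<chi> c \<and> independent_set G (bad_vertices G c)"
  have "\<exists>l c. proper_coloring G l c"
    using ex_dynamic_coloring[OF assms(1)] by (auto simp: dynamic_coloring_def)
  then have "\<exists>c. proper_coloring G ?\<chi> c"
    unfolding chromatic_number_def by (rule LeastI_ex)
  then obtain c0 where "?good c0"
    using ex_coloring_independent_bad[OF _ assms(2)] by blast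
  then obtain c where c: "proper_coloring G ?\<chi> c" "independent_set G (bad_vertices G c)"
    and least: "\<And>d. ?good d \<Longrightarrow> card (bad_vertices G c) \<le> card (bad_vertices G d)"
    using ex_has_least_nat[of ?good c0 "\<lambda>c. card (bad_vertices G c)"] by blast
  show ?thesis
  proof (intro conjI allI impI)
    have "card (bad_vertices G c) \<le> independence_number G"
      using pair_finite_verts c(2) by (rule card_le_independence_number)
    then show "dynamic_chromatic_number G \<le> ?\<chi> + independence_number G"
      using dynamic_chromatic_number_le_bad[OF c(1)] by simp
  next
    fix k assume "regular_graph k G"
    then have reg: "card (neighbors G v) = k" if "v \<in> pverts G" for v
      using that by (simp add: regular_graph_def out_degree_eq)
    have "card B' < card (\<Union>(neighbors G ` B'))"
      if "B' \<subseteq> bad_vertices G c" "B' \<noteq> {}" for B'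
      using minimal_bad_expansion[OF reg assms(2) c _ that] least by blast
    then have "\<exists>f. \<forall>v\<in>bad_vertices G c.
        (\<exists>x\<in>neighbors G v. f x) \<and> (\<exists>x\<in>neighbors G v. \<not> f x)"
      by (intro ex_two_coloring) simp_all
    then obtain f where "\<And>v. v \<in> bad_vertices G c \<Longrightarrow>
        (\<exists>x\<in>neighbors G v. f x) \<and> (\<exists>x\<in>neighbors G v. \<not> f x)"
      by blast
    then show "dynamic_chromatic_number G \<le> ?\<chi> + independence_number (graph_square G)"
      by (rule dynamic_chromatic_number_le_square[OF c])
  qed
qed

end
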